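(* No semi-online rule always satisfies fixed-rank-JR, and no semi-online rule always satisfies fixed-rank-PSC, even on profiles that are single-peaked with respect to a common axis (the same axis in all rounds). Hence, no semi-online rule always satisfies fixed-rank-PJR.
   Context: Model. Voters $V=[n]$, a set $C$ of $m$ candidates, rounds $T=\{1,\dots,|T|\}$ with $n,m,|T|\ge1$; $|T|$ is the horizon. In each round $j$ each voter $i$ has a strict complete ranking of $C$; the round-$j$ profile $P^j$ is the tuple of these rankings and the profile is $P=(P^1,\dots,P^{|T|})$. The rankings in a round are single-peaked with respect to a linear order (axis) of $C$ if, for every voter, candidates are ranked lower as one moves away from her first choice along the axis in either direction. $A_i^j(r)$ is the set of voter $i$'s $r$ most-preferred candidates in round $j$, for $r\in[m]$. A group is a nonempty $S\subseteq V$. A temporal voting rule maps $(V,T,C,P)$ to a sequence $W=(w^1,\dots,w^{|T|})\in C^{|T|}$. It is semi-online if, for every $j$, its choice of $w^j$ depends only on $P^1,\dots,P^j$ and $|T|$ (besides $V$ and $C$). A rule always satisfies an axiom (on a class of profiles) if its output satisfies the axiom for every input (in that class). For a cutoff $r\in[m]$: $S$ agrees in round $j$ if $\bigcap_{i\in S}A_i^j(r)\ne\varnothing$; is solid in round $j$ if $|\bigcap_{i\in S}A_i^j(r)|=r$; is represented in round $j$ if $w^j\in\bigcup_{i\in S}A_i^j(r)$. $W$ satisfies fixed-rank-PJR if for every $r\in[m]$, every positive integer $\ell$, and every group $S$ that agrees in $k>0$ rounds under cutoff $r$ with $|S|\ge\ell n/k$, $S$ is represented in at least $\ell$ rounds.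 Fixed-rank-JR: the same with the conclusion that $S$ is represented in at least one round. Fixed-rank-PSC: the same as fixed-rank-PJR with "agrees" replaced by "is solid" (representation is counted over all rounds). *)

theory Defs
  imports Complex_Main "HOL-Library.Infinite_Typeclass"
    "HOL-Combinatorics.Multiset_Permutations"
begin

text \<open>
  An instance consists of the number \<open>n\<close> of voters (the voters are \<open>{1..n}\<close>), the horizon \<open>h\<close>
  (the rounds are \<open>{1..h}\<close>), the candidate set \<open>C\<close>, and a profile. A ranking of \<open>C\<close> is a list
  without repetitions of all elements of \<open>C\<close>, most preferred candidate first. \<open>P j i\<close> is the
  ranking of voter \<open>i\<close> in round \<open>j\<close>; values of \<open>P\<close> outside \<open>{1..h}\<close> and \<open>{1..n}\<close> are irrelevant,
  and so are values of an outcome \<open>W\<close> outside \<open>{1..h}\<close>.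
\<close>

type_synonym 'c round_profile = "nat \<Rightarrow> 'c list"
type_synonym 'c profile = "nat \<Rightarrow> 'c round_profile"
type_synonym 'c outcome = "nat \<Rightarrow> 'c"
type_synonym 'c temporal_rule = "nat \<Rightarrow> nat \<Rightarrow> 'c set \<Rightarrow> 'c profile \<Rightarrow> 'c outcome"

definition valid_instance :: "nat \<Rightarrow> nat \<Rightarrow> 'c set \<Rightarrow> 'c profile \<Rightarrow> bool" where
  "valid_instance n h C P \<longleftrightarrow> n \<ge> 1 \<and> h \<ge> 1 \<and> finite C \<and> C \<noteq> {} \<and>
     (\<forall>j\<in>{1..h}. \<forall>i\<in>{1..n}. P j i \<in> permutations_of_set C)"

definition before :: "'c list \<Rightarrow> 'c \<Rightarrow> 'c \<Rightarrow> bool" where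
  "before xs a b \<longleftrightarrow> (\<exists>p q. p < q \<and> q < length xs \<and> xs ! p = a \<and> xs ! q = b)"

text \<open>
  The axis is a list as well, read from left to right. The two disjuncts are the moves away from
  the first choice \<open>hd rk\<close> to the right and to the left, first reaching \<open>a\<close> and then \<open>b\<close>.
\<close>

definition single_peaked_ranking :: "'c list \<Rightarrow> 'c list \<Rightarrow> bool" where
  "single_peaked_ranking axis rk \<longleftrightarrow>
     (\<forall>a b. (before axis (hd rk) a \<and> before axis a b) \<or>
            (before axis b a \<and> before axis a (hd rk)) \<longrightarrow> before rk a b)"

definition common_axis_single_peaked :: "nat \<Rightarrow> nat \<Rightarrow> 'c set \<Rightarrow> 'c profile \<Rightarrow> bool" where
  "common_axis_single_peaked n h C P \<longleftrightarrow>
     (\<exists>axis\<in>permutations_of_set C. \<forall>j\<in>{1..h}. \<forall>i\<in>{1..n}. single_peaked_ranking axis (P j i))"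

definition all_profiles :: "nat \<Rightarrow> nat \<Rightarrow> 'c set \<Rightarrow> 'c profile \<Rightarrow> bool" where
  "all_profiles n h C P \<longleftrightarrow> True"

definition temporal_voting_rule :: "'c temporal_rule \<Rightarrow> bool" where
  "temporal_voting_rule R \<longleftrightarrow>
     (\<forall>n h C P. valid_instance n h C P \<longrightarrow> (\<forall>j\<in>{1..h}. R n h C P j \<in> C))"

text \<open>
  For \<open>j = h\<close> this also says that the outcome ignores the irrelevant values of the profile.
\<close>

definition semi_online :: "'c temporal_rule \<Rightarrow> bool" where
  "semi_online R \<longleftrightarrow>
     (\<forall>n h C P P'. valid_instance n h C P \<longrightarrow> valid_instance n h C P' \<longrightarrow>
        (\<forall>j\<in>{1..h}. (\<forall>j'\<in>{1..j}. \<forall>i\<in>{1..n}. P j' i = P' j' i) \<longrightarrow> R n h C P j = R n h C P' j))"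

definition top_set :: "'c round_profile \<Rightarrow> nat \<Rightarrow> nat \<Rightarrow> 'c set" where
  "top_set Pj r i = set (take r (Pj i))"

definition agrees :: "'c round_profile \<Rightarrow> nat \<Rightarrow> nat set \<Rightarrow> bool" where
  "agrees Pj r S \<longleftrightarrow> (\<Inter>i\<in>S. top_set Pj r i) \<noteq> {}"

definition solid :: "'c round_profile \<Rightarrow> nat \<Rightarrow> nat set \<Rightarrow> bool" where
  "solid Pj r S \<longleftrightarrow> card (\<Inter>i\<in>S. top_set Pj r i) = r"

definition represented :: "'c round_profile \<Rightarrow> nat \<Rightarrow> nat set \<Rightarrow> 'c \<Rightarrow> bool" where
  "represented Pj r S w \<longleftrightarrow> w \<in> (\<Union>i\<in>S. top_set Pj r i)"

definition fixed_rank_PJR :: "nat \<Rightarrow> nat \<Rightarrow> 'c set \<Rightarrow> 'c profile \<Rightarrow> 'c outcome \<Rightarrow> bool" where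
  "fixed_rank_PJR n h C P W \<longleftrightarrow>
     (\<forall>r\<in>{1..card C}. \<forall>l\<ge>1. \<forall>S k. S \<subseteq> {1..n} \<longrightarrow> S \<noteq> {} \<longrightarrow>
        k = card {j\<in>{1..h}. agrees (P j) r S} \<longrightarrow> k > 0 \<longrightarrow>
        real (card S) \<ge> real l * real n / real k \<longrightarrow>
        card {j\<in>{1..h}. represented (P j) r S (W j)} \<ge> l)"

definition fixed_rank_JR :: "nat \<Rightarrow> nat \<Rightarrow> 'c set \<Rightarrow> 'c profile \<Rightarrow> 'c outcome \<Rightarrow> bool" where
  "fixed_rank_JR n h C P W \<longleftrightarrow>
     (\<forall>r\<in>{1..card C}. \<forall>l::nat. l \<ge> 1 \<longrightarrow> (\<forall>S k. S \<subseteq> {1..n} \<longrightarrow> S \<noteq> {} \<longrightarrow>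
        k = card {j\<in>{1..h}. agrees (P j) r S} \<longrightarrow> k > 0 \<longrightarrow>
        real (card S) \<ge> real l * real n / real k \<longrightarrow>
        card {j\<in>{1..h}. represented (P j) r S (W j)} \<ge> 1))"

definition fixed_rank_PSC :: "nat \<Rightarrow> nat \<Rightarrow> 'c set \<Rightarrow> 'c profile \<Rightarrow> 'c outcome \<Rightarrow> bool" where
  "fixed_rank_PSC n h C P W \<longleftrightarrow>
     (\<forall>r\<in>{1..card C}. \<forall>l\<ge>1. \<forall>S k. S \<subseteq> {1..n} \<longrightarrow> S \<noteq> {} \<longrightarrow>
        k = card {j\<in>{1..h}. solid (P j) r S} \<longrightarrow> k > 0 \<longrightarrow>
        real (card S) \<ge> real l * real n / real k \<longrightarrow>
        card {j\<in>{1..h}. represented (P j) r S (W j)} \<ge> l)"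

definition always_satisfies ::
  "'c temporal_rule \<Rightarrow> (nat \<Rightarrow> nat \<Rightarrow> 'c set \<Rightarrow> 'c profile \<Rightarrow> 'c outcome \<Rightarrow> bool) \<Rightarrow>
   (nat \<Rightarrow> nat \<Rightarrow> 'c set \<Rightarrow> 'c profile \<Rightarrow> bool) \<Rightarrow> bool" where
  "always_satisfies R ax D \<longleftrightarrow>
     (\<forall>n h C P. valid_instance n h C P \<longrightarrow> D n h C P \<longrightarrow> ax n h C P (R n h C P))"

end

theory Submission
  imports Defs "HOL-Library.Sublist"
begin

text \<open>
  There are 30 voters, 5 rounds and 30 candidates, both split into five blocks of six. In every round
  a voter may rank the six candidates of her block on top, with the six voters of a block having six
  different first choices. Each block of voters is then solid in all five rounds under cutoff 6, so
  the rule has to spend one round on each block. Suppose that rounds 1 and 2 went to blocks \<open>a\<close> and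
  \<open>b\<close>. All but at most two of the twelve voters of these blocks are still unrepresented under
  cutoff 1. If from round 3 on all of them have the same first choice, then ten of them form a group
  that is solid in three rounds under cutoff 1, and as \<open>10 \<ge> 30 / 3\<close> this group claims a round, too.
  Together with the three other blocks there are four disjoint claims on the three remaining rounds.
\<close>

section \<open>Precedence in a list\<close>

text \<open>In this form transitivity of \<open>subseq\<close> and \<open>subseq_map\<close> carry
  precedence from a part of a ranking to the whole ranking.\<close>

lemma before_iff_subseq: "before xs a b \<longleftrightarrow> subseq [a, b] xs"
proof (induction xs)
  case Nil
  then show ?case by (simp add: before_def)
next
  case (Cons x xs)
  have "before (x # xs) a b \<longleftrightarrow> (a = x \<and> b \<in> set xs) \<or> before xs a b"
  proof
    assume "before (x # xs) a b"
    then obtain p q where pq: "p < q" "q < length (x # xs)" "(x # xs) ! p = a" "(x # xs) ! q = b"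
      unfolding before_def by blast
    then obtain q' where q': "q = Suc q'" by (cases q) auto
    show "(a = x \<and> b \<in> set xs) \<or> before xs a b"
    proof (cases p)
      case 0
      then show ?thesis using pq q' by auto
    next
      case (Suc p')
      then have "before xs a b"
        unfolding before_def using pq q' by (intro exI[of _ p'] exI[of _ q']) auto
      then show ?thesis ..
    qed
  next
    assume "(a = x \<and> b \<in> set xs) \<or> before xs a b"
    then show "before (x # xs) a b"
    proof
      assume ab: "a = x \<and> b \<in> set xs"
      then obtain q where "q < length xs" "xs ! q = b" by (auto simp: in_set_conv_nth)
      with ab show ?thesis
        unfolding before_def by (intro exI[of _ 0] exI[of _ "Suc q"]) auto
    next
      assume "before xs a b"
      then obtain p q where "p < q" "q < length xs" "xs ! p = a" "xs ! q = b"
        unfolding before_def by blast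
      then show ?thesis
        unfolding before_def by (intro exI[of _ "Suc p"] exI[of _ "Suc q"]) auto
    qed
  qed
  also have "\<dots> \<longleftrightarrow> subseq [a, b] (x # xs)"
    unfolding Cons.IH by (auto simp: subseq_singleton_left dest: subseq_Cons')
  finally show ?case .
qed

lemma before_map_upt_iff:
  "before (map f [0..<N]) a b \<longleftrightarrow> (\<exists>p q. p < q \<and> q < N \<and> a = f p \<and> b = f q)"
proof
  assume "before (map f [0..<N]) a b"
  then show "\<exists>p q. p < q \<and> q < N \<and> a = f p \<and> b = f q"
    unfolding before_def by fastforce
next
  assume "\<exists>p q. p < q \<and> q < N \<and> a = f p \<and> b = f q"
  then obtain p q where "p < q" "q < N" "a = f p" "b = f q" by blast
  then show "before (map f [0..<N]) a b"
    unfolding before_def by (intro exI[of _ p] exI[of _ q]) auto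
qed

section \<open>Single-peaked rankings with a block on top\<close>

text \<open>A single-peaked ranking is a peak plus an interleaving of its left and right sides. This
  interleaving exhausts the block of \<open>v\<close> before leaving it, so that different peaks in
  one block share their top \<open>g\<close> candidates.\<close>

definition block_ranking :: "nat \<Rightarrow> nat \<Rightarrow> nat \<Rightarrow> nat list" where
  "block_ranking g N v =
     (let s = v div g * g
      in (v # rev [s..<v]) @ [Suc v..<s + g] @ rev [0..<s] @ [s + g..<N])"

lemma block_end_le:
  fixes g N v :: nat
  assumes "g dvd N" "v < N"
  shows "v < v div g * g + g" "v div g * g + g \<le> N"
proof -
  obtain k where k: "N = g * k" using assms(1) by (rule dvdE)
  with assms(2) have "g > 0" by (cases g) auto
  then show "v < v div g * g + g" using dividend_less_div_times[of g v] by simp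
  have "v div g < k" using assms(2) k by (simp add: less_mult_imp_div_less mult.commute)
  then have "Suc (v div g) * g \<le> k * g" by (intro mult_le_mono1) simp
  then show "v div g * g + g \<le> N" using k by (simp add: algebra_simps)
qed

lemma block_ranking_permutation:
  assumes "g dvd N" "v < N"
  shows "block_ranking g N v \<in> permutations_of_set {..<N}"
proof -
  define s where "s = v div g * g"
  have "s \<le> v" "v < s + g" "s + g \<le> N" using block_end_le[OF assms] by (auto simp: s_def)
  then show ?thesis
    unfolding permutations_of_set_def block_ranking_def Let_def s_def[symmetric] by auto
qed

lemma hd_block_ranking: "hd (block_ranking g N v) = v"
  by (simp add: block_ranking_def Let_def)

lemma take_1_block_ranking: "take 1 (block_ranking g N v) = [v]"
  by (simp add: block_ranking_def Let_def)

lemma set_take_block_ranking: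
  assumes "g dvd N" "v < N"
  shows "set (take g (block_ranking g N v)) = {v div g * g..<v div g * g + g}"
proof -
  define s where "s = v div g * g"
  have s: "s \<le> v" "v < s + g" using block_end_le[OF assms] by (auto simp: s_def)
  define xs where "xs = (v # rev [s..<v]) @ [Suc v..<s + g]"
  have "length xs = g" using s by (simp add: xs_def)
  moreover have "block_ranking g N v = xs @ rev [0..<s] @ [s + g..<N]"
    by (simp add: block_ranking_def Let_def s_def xs_def)
  ultimately have "take g (block_ranking g N v) = xs" by simp
  then show ?thesis using s by (auto simp: xs_def s_def[symmetric])
qed

lemma subseq_right_block_ranking:
  assumes "g dvd N" "v < N"
  shows "subseq [Suc v..<N] (block_ranking g N v)"
proof -
  define s where "s = v div g * g"
  have "Suc v \<le> s + g" "s + g \<le> N" using block_end_le[OF assms] by (auto simp: s_def)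
  then have "[Suc v..<N] = [Suc v..<s + g] @ [s + g..<N]"
    using upt_add_eq_append[of "Suc v" "s + g" "N - (s + g)"] by simp
  then show ?thesis
    unfolding block_ranking_def Let_def s_def[symmetric]
    by (metis list_emb_append2 list_emb_append_mono subseq_order.refl)
qed

lemma subseq_left_block_ranking: "subseq (rev [0..<v]) (block_ranking g N v)"
proof -
  define s where "s = v div g * g"
  have "s \<le> v" by (simp add: s_def)
  then have "rev [0..<v] = rev [s..<v] @ rev [0..<s]"
    using upt_add_eq_append[of 0 s "v - s"] by simp
  moreover have "subseq (rev [s..<v]) (v # rev [s..<v])" by auto
  moreover have "subseq (rev [0..<s]) ([Suc v..<s + g] @ rev [0..<s] @ [s + g..<N])"
    by (metis list_emb_append2 list_emb_prefix subseq_order.refl)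
  ultimately show ?thesis
    unfolding block_ranking_def Let_def s_def[symmetric]
    by (metis list_emb_append_mono)
qed

lemma before_upt: "a < b \<Longrightarrow> m \<le> a \<Longrightarrow> b < N \<Longrightarrow> before [m..<N] a b"
  unfolding before_def by (intro exI[of _ "a - m"] exI[of _ "b - m"]) auto

lemma before_rev_upt: "b < a \<Longrightarrow> a < N \<Longrightarrow> before (rev [0..<N]) a b"
  unfolding before_def
  by (intro exI[of _ "N - Suc a"] exI[of _ "N - Suc b"]) (auto simp: rev_nth)

text \<open>A move away from the peak stays on one side of it, and each side occurs in the ranking
  as a subsequence ordered by distance from \<open>v\<close>.\<close>

lemma single_peaked_block_ranking:
  assumes f: "inj f" and N: "g dvd N" "v < N"
  shows "single_peaked_ranking (map f [0..<N]) (map f (block_ranking g N v))"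
proof -
  let ?rk = "block_ranking g N v"
  have hd: "hd (map f ?rk) = f v"
    using hd_block_ranking[of g N v] by (simp add: block_ranking_def Let_def)
  have lift: "before (map f ?rk) (f a) (f b)" if "before xs a b" "subseq xs ?rk" for xs a b
  proof -
    have "subseq [a, b] ?rk" using that unfolding before_iff_subseq by (rule subseq_order.trans)
    from subseq_map[OF this, of f] show ?thesis by (simp add: before_iff_subseq)
  qed
  show ?thesis
    unfolding single_peaked_ranking_def hd before_map_upt_iff
  proof (intro allI impI, elim disjE conjE exE)
    fix x y p q p' q'
    assume "p < q" "q < N" "f v = f p" "x = f q" and *: "p' < q'" "q' < N" "x = f p'" "y = f q'"
    then have "Suc v \<le> p'" by (simp add: inj_eq[OF f])
    with * show "before (map f ?rk) x y"
      using lift[OF before_upt subseq_right_block_ranking[OF N]] by auto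
  next
    fix x y p q p' q'
    assume "p < q" "q < N" "y = f p" "x = f q" and *: "p' < q'" "q' < N" "x = f p'" "f v = f q'"
    then have "q < v" by (simp add: inj_eq[OF f])
    with \<open>p < q\<close> \<open>y = f p\<close> \<open>x = f q\<close> show "before (map f ?rk) x y"
      using lift[OF before_rev_upt subseq_left_block_ranking] by auto
  qed
qed

section \<open>A consequence shared by the three axioms\<close>

lemma solid_imp_agrees: "solid Pj r S \<Longrightarrow> r \<ge> 1 \<Longrightarrow> agrees Pj r S"
  by (auto simp: solid_def agrees_def)

text \<open>A group solid in the rounds of \<open>J\<close> also agrees in them, so
  \<open>card J\<close> is a lower bound for either count of rounds, and each axiom applies with
  \<open>l = 1\<close>. Hence one profile can defeat all three axioms.\<close>

lemma represented_if_solid: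
  assumes ax: "fixed_rank_JR n h C P W \<or> fixed_rank_PSC n h C P W \<or> fixed_rank_PJR n h C P W"
    and r: "r \<in> {1..card C}" and S: "S \<subseteq> {1..n}" "S \<noteq> {}"
    and J: "J \<subseteq> {1..h}" "\<And>j. j \<in> J \<Longrightarrow> solid (P j) r S"
    and size: "n \<le> card S * card J"
  shows "\<exists>j\<in>{1..h}. represented (P j) r S (W j)"
proof -
  let ?ks = "card {j\<in>{1..h}. solid (P j) r S}"
  let ?ka = "card {j\<in>{1..h}. agrees (P j) r S}"
  have "n \<ge> 1" using S by auto
  then have "card J > 0" using size by (cases "card J") auto
  moreover have "card J \<le> ?ks" using J by (intro card_mono) auto
  moreover have "?ks \<le> ?ka"
    using r solid_imp_agrees[of _ r S] by (intro card_mono) auto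
  ultimately have k: "?ks > 0" "?ka > 0" "card J \<le> ?ks" "card J \<le> ?ka" by linarith+
  have "real (card S) \<ge> real 1 * real n / real k" if "card J \<le> k" for k
  proof -
    have "n \<le> card S * k" using size that by (meson le_trans mult_le_mono2)
    then have "real n \<le> real (card S) * real k" by (metis of_nat_le_iff of_nat_mult)
    then show ?thesis using that \<open>card J > 0\<close> by (simp add: divide_le_eq)
  qed
  note quota = this[OF k(3)] this[OF k(4)]
  from ax have "card {j\<in>{1..h}. represented (P j) r S (W j)} \<ge> 1"
  proof (elim disjE)
    assume "fixed_rank_JR n h C P W"
    then show ?thesis
      unfolding fixed_rank_JR_def using r S k quota by blast
  next
    assume "fixed_rank_PSC n h C P W"
    then show ?thesis
      unfolding fixed_rank_PSC_def using r S k quota by blast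
  next
    assume "fixed_rank_PJR n h C P W"
    then show ?thesis
      unfolding fixed_rank_PJR_def using r S k quota by blast
  qed
  then have "{j\<in>{1..h}. represented (P j) r S (W j)} \<noteq> {}"
    by (metis card.empty not_one_le_zero)
  then show ?thesis by blast
qed

section \<open>The adversarial profile\<close>

lemma semi_online_violation:
  fixes R :: "('c :: infinite) temporal_rule"
  assumes rule: "temporal_voting_rule R" and online: "semi_online R"
  obtains n h C P where "valid_instance n h C P" "common_axis_single_peaked n h C P"
    "\<not> fixed_rank_JR n h C P (R n h C P)" "\<not> fixed_rank_PSC n h C P (R n h C P)"
    "\<not> fixed_rank_PJR n h C P (R n h C P)"
proof -
  obtain f :: "nat \<Rightarrow> 'c" where f: "inj f"
    using infinite_UNIV infinite_countable_subset by blast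
  then have f_on: "inj_on f A" for A by (rule inj_on_subset) simp
  define C where "C = f ` {..<30}"
  have C: "finite C" "C \<noteq> {}" "card C = 30"
    unfolding C_def using f_on by (auto simp: card_image lessThan_empty_iff)
  define rk where "rk v = map f (block_ranking 6 30 v)" for v
  have rk_perm: "rk v \<in> permutations_of_set C" if "v < 30" for v
  proof -
    have "block_ranking 6 30 v \<in> permutations_of_set {..<30}"
      using that by (intro block_ranking_permutation) auto
    then show ?thesis
      using f by (auto simp: rk_def C_def permutations_of_set_def distinct_map f_on)
  qed
  have rk_1: "set (take 1 (rk v)) = {f v}" for v
    unfolding rk_def take_map take_1_block_ranking by simp
  have rk_6: "set (take 6 (rk v)) = f ` {6 * (v div 6)..<6 * (v div 6) + 6}" if "v < 30" for v
    unfolding rk_def take_map set_map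
    using set_take_block_ranking[of 6 30 v] that by (simp add: mult.commute)
  \<comment> \<open>A ranking \<open>rk v\<close> is determined by its peak, so a profile is given
    by the numbers \<open>V j i\<close> of the first choices.\<close>
  have valid: "valid_instance 30 5 C (\<lambda>j i. rk (V j i))"
    and peaked: "common_axis_single_peaked 30 5 C (\<lambda>j i. rk (V j i))"
    if V: "\<And>j i. i \<in> {1..30} \<Longrightarrow> V j i < 30" for V :: "nat \<Rightarrow> nat \<Rightarrow> nat"
  proof -
    show "valid_instance 30 5 C (\<lambda>j i. rk (V j i))"
      unfolding valid_instance_def using C rk_perm V by auto
    have "map f [0..<30] \<in> permutations_of_set C"
      using f by (auto simp: C_def permutations_of_set_def distinct_map f_on atLeast0LessThan)
    moreover have "single_peaked_ranking (map f [0..<30]) (rk (V j i))" if "i \<in> {1..30}" for i j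
      unfolding rk_def using single_peaked_block_ranking[OF f, of 6 30] V[OF that] by simp
    ultimately show "common_axis_single_peaked 30 5 C (\<lambda>j i. rk (V j i))"
      unfolding common_axis_single_peaked_def by blast
  qed

  \<comment> \<open>The probe profile: voters are numbered from 1 and candidates from 0, so voter
    \<open>i\<close> has peak \<open>i - 1\<close>. The first two winners on it determine the final
    profile.\<close>
  have valid0: "valid_instance 30 5 C (\<lambda>j i. rk (i - 1))"
    by (rule valid) auto
  let ?W0 = "R 30 5 C (\<lambda>j i. rk (i - 1))"
  have "?W0 j \<in> C" if "j \<in> {1..5}" for j
    using rule valid0 that unfolding temporal_voting_rule_def by blast
  then have "?W0 1 \<in> C" "?W0 2 \<in> C" by simp_all
  then obtain q1 q2 where q: "q1 < 30" "?W0 1 = f q1" "q2 < 30" "?W0 2 = f q2"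
    unfolding C_def by auto
  define a where "a = q1 div 6"
  \<comment> \<open>If both winners lie in block \<open>a\<close>, any other block can serve as
    \<open>b\<close>.\<close>
  define b where "b = (if q2 div 6 \<noteq> a then q2 div 6 else if a = 0 then 1 else 0)"
  have ab: "a < 5" "b < 5" "a \<noteq> b" "q1 div 6 = a" "q2 div 6 \<in> {a, b}"
    using q unfolding a_def b_def by auto

  \<comment> \<open>This agrees with the probe profile in rounds 1 and 2, so a semi-online rule
    repeats its two choices. Candidate \<open>6 * a\<close> is the first one of block
    \<open>a\<close>.\<close>
  define V where "V j i = (if j \<ge> 3 \<and> (i - 1) div 6 \<in> {a, b} then 6 * a else i - 1)"
    for j i :: nat
  have V: "V j i < 30" if "i \<in> {1..30}" for i j
    using that \<open>a < 5\<close> by (simp add: V_def; linarith)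
  define P where "P = (\<lambda>j i. rk (V j i))"
  define W where "W = R 30 5 C P"
  have validP: "valid_instance 30 5 C P" and peakedP: "common_axis_single_peaked 30 5 C P"
    unfolding P_def using valid[of V] peaked[of V] V by auto
  have "W j = ?W0 j" if "j \<in> {1, 2}" for j
  proof -
    have "\<forall>j'\<in>{1..j}. \<forall>i\<in>{1..30}. P j' i = rk (i - 1)"
      using that by (auto simp: P_def V_def)
    moreover have "j \<in> {1..5}" using that by auto
    ultimately show ?thesis
      using online validP valid0 unfolding semi_online_def W_def by blast
  qed
  then have W12: "W 1 = f q1" "W 2 = f q2" using q by simp_all

  have "\<not> (fixed_rank_JR 30 5 C P W \<or> fixed_rank_PSC 30 5 C P W \<or> fixed_rank_PJR 30 5 C P W)"
  proof
    assume ax: "fixed_rank_JR 30 5 C P W \<or> fixed_rank_PSC 30 5 C P W \<or> fixed_rank_PJR 30 5 C P W"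
    \<comment> \<open>Block \<open>b\<close> is left out because its voters join those of
      \<open>a\<close> in the claim for \<open>c = a\<close>, which only \<open>f (6 * a)\<close>
      can satisfy.\<close>
    have late: "\<exists>j\<in>{3..5}. \<exists>p. W j = f p \<and> p div 6 = c" if c: "c \<in> {..<5} - {b}" for c
    proof (cases "c = a")
      case True
      \<comment> \<open>The removed voters are those whose first choice wins round 1 or 2.\<close>
      define X where "X = {6 * a + 1..6 * a + 6} \<union> {6 * b + 1..6 * b + 6} - {q1 + 1, q2 + 1}"
      have X_div: "(i - 1) div 6 \<in> {a, b}" "i \<ge> 1" "i - 1 \<noteq> q1" "i - 1 \<noteq> q2" if "i \<in> X" for i
        using that unfolding X_def by auto
      have "X \<subseteq> {1..30}" using ab by (auto simp: X_def)
      have "{6 * a + 1..6 * a + 6} \<inter> {6 * b + 1..6 * b + 6} = {}" using ab(3) by auto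
      then have "card ({6 * a + 1..6 * a + 6} \<union> {6 * b + 1..6 * b + 6}) = 12"
        by (simp add: card_Un_disjoint)
      moreover have "card {q1 + 1, q2 + 1} \<le> 2" by (simp add: card_insert_if)
      moreover have "card X \<ge> card ({6 * a + 1..6 * a + 6} \<union> {6 * b + 1..6 * b + 6})
          - card {q1 + 1, q2 + 1}"
        unfolding X_def by (rule diff_card_le_card_Diff) simp
      ultimately have cardX: "card X \<ge> 10" by linarith
      then have "X \<noteq> {}" by auto
      have top: "top_set (P j) 1 i = {f (6 * a)}" if "j \<ge> 3" "i \<in> X" for i j
        using X_div[OF that(2)] that by (auto simp: top_set_def P_def V_def rk_1[simplified])
      have "\<exists>j\<in>{1..5}. represented (P j) 1 X (W j)"
      \<comment> \<open>The size condition is \<open>30 \<le> 10 * 3\<close>.\<close>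
      proof (rule represented_if_solid[OF ax, where J = "{3..5}"])
        show "solid (P j) 1 X" if "j \<in> {3..5}" for j
          unfolding solid_def using top that \<open>X \<noteq> {}\<close> by simp
      qed (use C cardX \<open>X \<subseteq> {1..30}\<close> \<open>X \<noteq> {}\<close> in auto)
      then obtain j i where j: "j \<in> {1..5}" and i: "i \<in> X" "W j \<in> top_set (P j) 1 i"
        unfolding represented_def by auto
      \<comment> \<open>In rounds 1 and 2 the voters of \<open>X\<close> still have their probe
        peaks, none of which wins there.\<close>
      have "j \<ge> 3"
      proof (rule ccontr)
        assume "\<not> j \<ge> 3"
        then have "j = 1 \<or> j = 2" "W j = f (i - 1)"
          using i j by (auto simp: top_set_def P_def V_def rk_1[simplified])
        then show False using W12 X_div[OF i(1)] by (auto simp: inj_eq[OF f])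
      qed
      then have "W j = f (6 * a)" using top i by auto
      then show ?thesis using \<open>j \<ge> 3\<close> j True by (intro bexI[of _ j] exI[of _ "6 * a"]) auto
    next
      case False
      define Q where "Q = {6 * c + 1..6 * c + 6}"
      have "Q \<subseteq> {1..30}" "Q \<noteq> {}" "card Q = 6" using c by (auto simp: Q_def)
      have top: "top_set (P j) 6 i = f ` {6 * c..<6 * c + 6}" if "i \<in> Q" for i j
      proof -
        have "(i - 1) div 6 = c" "i - 1 < 30" using that c by (auto simp: Q_def)
        then have "P j i = rk (i - 1)" using c False by (auto simp: P_def V_def)
        then show ?thesis
          using rk_6[of "i - 1"] \<open>(i - 1) div 6 = c\<close> \<open>i - 1 < 30\<close> by (simp add: top_set_def)
      qed
      have "\<exists>j\<in>{1..5}. represented (P j) 6 Q (W j)"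
      \<comment> \<open>Here the size condition holds with equality,
        \<open>30 = 6 * 5\<close>.\<close>
      proof (rule represented_if_solid[OF ax, where J = "{1..5}"])
        show "solid (P j) 6 Q" if "j \<in> {1..5}" for j
          unfolding solid_def using top \<open>Q \<noteq> {}\<close> f_on by (simp add: card_image)
      qed (use C \<open>Q \<subseteq> {1..30}\<close> \<open>Q \<noteq> {}\<close> \<open>card Q = 6\<close> in auto)
      then obtain j where j: "j \<in> {1..5}" "W j \<in> f ` {6 * c..<6 * c + 6}"
        unfolding represented_def using top by blast
      then obtain p where p: "W j = f p" "p div 6 = c" by auto
      \<comment> \<open>The first two winners lie in blocks \<open>a\<close> and \<open>b\<close>,
        and \<open>c\<close> is neither.\<close>
      have "j \<noteq> 1" "j \<noteq> 2"
        using W12 p c False ab by (auto simp: inj_eq[OF f])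
      then show ?thesis using j p by (intro bexI[of _ j] exI[of _ p]) auto
    qed
    then obtain F where F: "\<And>c. c \<in> {..<5} - {b} \<Longrightarrow> F c \<in> {3..5} \<and> (\<exists>p. W (F c) = f p \<and> p div 6 = c)"
      by metis
    \<comment> \<open>The winner of a round lies in a single block, so four claims would need four
      distinct rounds among three.\<close>
    have "inj_on F ({..<5} - {b})"
    proof (rule inj_onI)
      fix c d assume "c \<in> {..<5} - {b}" "d \<in> {..<5} - {b}" "F c = F d"
      then show "c = d" using F[of c] F[of d] f by (metis injD)
    qed
    moreover have "F ` ({..<5} - {b}) \<subseteq> {3..5}" using F by blast
    ultimately have "card ({..<5} - {b}) \<le> card {3..5::nat}"
      by (intro card_inj_on_le) auto
    then show False using ab by simp
  qed
  then show ?thesis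
    using that[OF validP peakedP] unfolding W_def by blast
qed

theorem theorem4p3:
  fixes R :: "('c :: infinite) temporal_rule"
  assumes "temporal_voting_rule R" and "semi_online R"
  shows "\<not> always_satisfies R fixed_rank_JR all_profiles
       \<and> \<not> always_satisfies R fixed_rank_JR common_axis_single_peaked
       \<and> \<not> always_satisfies R fixed_rank_PSC all_profiles
       \<and> \<not> always_satisfies R fixed_rank_PSC common_axis_single_peaked
       \<and> \<not> always_satisfies R fixed_rank_PJR all_profiles"
proof -
  obtain n h C P where "valid_instance n h C P" "common_axis_single_peaked n h C P"
    "\<not> fixed_rank_JR n h C P (R n h C P)" "\<not> fixed_rank_PSC n h C P (R n h C P)"
    "\<not> fixed_rank_PJR n h C P (R n h C P)"
    using semi_online_violation[OF assms] .
  then show ?thesis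
    unfolding always_satisfies_def all_profiles_def by blast
qed

end
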